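(* Let $m,n\ge 1$ and let $S=\{p_1,\dots,p_m\}$ be a set of $m$ probability distributions, each with $n$ states. Let $\mathcal{G}_S$ be the sequence of state weights produced by the greedy coupling algorithm on $S$, and let $\mathcal{M}_S=\bigwedge S$. Then for every $i\ge 1$, $$\mathcal{G}_S(i)\ \ge\ \max_{1\le j\le n}\ \frac{\sum_{k=1}^{j}\mathcal{M}_S(k)-\sum_{k=1}^{i-1}\mathcal{G}_S(k)}{j}.$$
   Context: The states of every distribution $p$ in $S$ are indexed in non-increasing order, $p(1)\ge p(2)\ge\cdots$. Majorization: $p\preceq q$ ($p$ is majorized by $q$) if $\sum_{j=1}^i p(j)\le\sum_{j=1}^i q(j)$ for all $i$. $\bigwedge S$, also written $\mathcal{M}_S$, is the greatest lower bound of $S$ for $\preceq$; explicitly it is the distribution on $n$ states with $\sum_{j=1}^i\mathcal{M}_S(j)=\min_{p\in S}\sum_{j=1}^i p(j)$ for every $i\in\{1,\dots,n\}$. Greedy coupling algorithm: set $p_\ell^1=p_\ell$ for $\ell=1,\dots,m$. At step $t=1,2,\dots$, as long as the remaining mass $\sum_k p_1^t(k)$ is positive, for each $\ell$ choose an index $k_\ell$ maximizing $p_\ell^t(k)$ over $k\in\{1,\dots,n\}$, set $\mathcal{G}_S(t)=\min_{\ell}p_\ell^t(k_\ell)$, and let $p_\ell^{t+1}$ be obtained from $p_\ell^t$ by subtracting $\mathcal{G}_S(t)$ from its entry at index $k_\ell$ (entries are not re-indexed). The output weights $\mathcal{G}_S(1),\mathcal{G}_S(2),\dots$ form a probability distribution,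 denoted $\mathcal{G}_S$ (with $\mathcal{G}_S(t)=0$ after termination). *)

theory Defs
  imports Complex_Main "HOL-Algebra.Lattice"
begin

text \<open>
  A distribution with \<open>n\<close> states is a function on \<open>nat\<close> whose states are the indices
  \<open>1, \<dots>, n\<close>. It is required to vanish elsewhere, so that equality of functions is equality of
  distributions and majorization is antisymmetric.
\<close>

definition ordered_dists :: "nat \<Rightarrow> (nat \<Rightarrow> real) set" where
  "ordered_dists n =
     {p. (\<forall>k\<in>{1..n}. 0 \<le> p k) \<and> (\<Sum>k=1..n. p k) = 1 \<and>
         (\<forall>k. k \<notin> {1..n} \<longrightarrow> p k = 0) \<and> antimono_on {1..n} p}"

definition majorized :: "(nat \<Rightarrow> real) \<Rightarrow> (nat \<Rightarrow> real) \<Rightarrow> bool" where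
  "majorized p q \<longleftrightarrow> (\<forall>i. (\<Sum>j=1..i. p j) \<le> (\<Sum>j=1..i. q j))"

definition majorization_order :: "nat \<Rightarrow> (nat \<Rightarrow> real) gorder" where
  "majorization_order n = \<lparr>carrier = ordered_dists n, eq = (=), le = majorized\<rparr>"

definition majorization_meet :: "nat \<Rightarrow> (nat \<Rightarrow> real) set \<Rightarrow> nat \<Rightarrow> real" where
  "majorization_meet n S = \<Sqinter>\<^bsub>majorization_order n\<^esub> S"

text \<open>
  The rule for breaking ties between maximizing indices is left open: \<open>greedy_step\<close> is a relation
  between the state \<open>P\<close> of the algorithm (\<open>P l k\<close> is the remaining mass at index \<open>k\<close> of the
  \<open>l\<close>-th distribution), the weight \<open>g\<close> it outputs and the next state \<open>Q\<close>.
\<close>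

definition greedy_step ::
  "nat \<Rightarrow> nat \<Rightarrow> (nat \<Rightarrow> nat \<Rightarrow> real) \<Rightarrow> real \<Rightarrow> (nat \<Rightarrow> nat \<Rightarrow> real) \<Rightarrow> bool" where
  "greedy_step m n P g Q \<longleftrightarrow>
     (\<exists>\<kappa>. (\<forall>l\<in>{1..m}. is_arg_max (P l) (\<lambda>k. k \<in> {1..n}) (\<kappa> l)) \<and>
          g = (MIN l\<in>{1..m}. P l (\<kappa> l)) \<and>
          (\<forall>l\<in>{1..m}. Q l = (P l)(\<kappa> l := P l (\<kappa> l) - g)))"

text \<open>
  \<open>greedy_output m n p G\<close>: some run of the algorithm on \<open>p 1, \<dots>, p m\<close> outputs the weights
  \<open>G 1, G 2, \<dots>\<close>. Steps are counted from 1; the value \<open>G 0\<close> is irrelevant.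
\<close>

definition greedy_output ::
  "nat \<Rightarrow> nat \<Rightarrow> (nat \<Rightarrow> nat \<Rightarrow> real) \<Rightarrow> (nat \<Rightarrow> real) \<Rightarrow> bool" where
  "greedy_output m n p G \<longleftrightarrow>
     (\<exists>P. (\<forall>l\<in>{1..m}. P 1 l = p l) \<and>
          (\<forall>t\<ge>1. if (\<Sum>k=1..n. P t 1 k) > 0
                  then greedy_step m n (P t) (G t) (P (Suc t))
                  else G t = 0 \<and> (\<forall>l\<in>{1..m}. P (Suc t) l = P t l)))"

lemma greedy_step_exists:
  assumes "n \<ge> 1"
  shows "\<exists>g Q. greedy_step m n P g Q"
proof -
  have "\<exists>k. is_arg_max (P l) (\<lambda>k. k \<in> {1..n}) k" for l
  proof -
    have "finite (P l ` {1..n})" "P l ` {1..n} \<noteq> {}"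
      using assms by auto
    from Max_in[OF this] obtain k where k: "k \<in> {1..n}" "P l k = Max (P l ` {1..n})"
      by (metis imageE)
    then have "is_arg_max (P l) (\<lambda>k. k \<in> {1..n}) k"
      by (auto simp: is_arg_max_linorder)
    then show ?thesis ..
  qed
  then obtain \<kappa> where "\<forall>l. is_arg_max (P l) (\<lambda>k. k \<in> {1..n}) (\<kappa> l)"
    by metis
  then show ?thesis
    unfolding greedy_step_def
    by (intro exI[of _ "MIN l\<in>{1..m}. P l (\<kappa> l)"]
        exI[of _ "\<lambda>l. (P l)(\<kappa> l := P l (\<kappa> l) - (MIN l\<in>{1..m}. P l (\<kappa> l)))"] exI[of _ \<kappa>]) auto
qed

lemma greedy_output_exists:
  assumes "n \<ge> 1"
  shows "\<exists>G. greedy_output m n p G"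
proof -
  let ?R = "\<lambda>P g Q. if (\<Sum>k=1..n. P 1 k) > 0 then greedy_step m n P g Q
                  else g = 0 \<and> (\<forall>l\<in>{1..m}. Q l = P l)"
  have ex: "\<exists>g Q. ?R P g Q" for P
    using greedy_step_exists[OF assms, of m P] by auto
  define g where "g P = (SOME g. \<exists>Q. ?R P g Q)" for P
  define q where "q P = (SOME Q. ?R P (g P) Q)" for P
  have "\<exists>Q. ?R P (g P) Q" for P
    unfolding g_def by (rule someI_ex[OF ex])
  then have R: "?R P (g P) (q P)" for P
    unfolding q_def by (rule someI_ex)
  define P where "P t = (q ^^ (t - 1)) p" for t :: nat
  have "P 1 = p"
    by (simp add: P_def)
  moreover have "if (\<Sum>k=1..n. P t 1 k) > 0 then greedy_step m n (P t) (g (P t)) (P (Suc t))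
        else g (P t) = 0 \<and> (\<forall>l\<in>{1..m}. P (Suc t) l = P t l)" if "t \<ge> 1" for t
  proof -
    have "P (Suc t) = q (P t)"
      using that by (cases t) (simp_all add: P_def)
    then show ?thesis
      using R[of "P t"] by (simp only:)
  qed
  ultimately have "greedy_output m n p (\<lambda>t. g (P t))"
    unfolding greedy_output_def by (intro exI[of _ P]) blast
  then show ?thesis by blast
qed

lemma concave_partial_sums:
  assumes "p \<in> ordered_dists n" "i \<ge> 1" "i < n"
  shows "(\<Sum>j=1..i-1. p j) + (\<Sum>j=1..Suc i. p j) \<le> 2 * (\<Sum>j=1..i. p j)"
proof -
  obtain i' where i: "i = Suc i'" using assms(2) by (cases i) auto
  have "p (Suc i) \<le> p i"
    using assms by (auto simp: ordered_dists_def monotone_on_def)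
  then show ?thesis by (simp add: i)
qed

lemma sum_ordered_dist_ge:
  assumes "p \<in> ordered_dists n" "i \<ge> n"
  shows "(\<Sum>j=1..i. p j) = 1"
proof -
  have "(\<Sum>j=1..i. p j) = (\<Sum>j=1..n. p j)"
    using assms by (intro sum.mono_neutral_right) (auto simp: ordered_dists_def)
  then show ?thesis using assms by (simp add: ordered_dists_def)
qed

lemma majorization_meet:
  assumes "finite S" "S \<noteq> {}" "S \<subseteq> ordered_dists n"
  shows "is_glb (majorization_order n) (majorization_meet n S) S"
    and "(\<Sum>j=1..i. majorization_meet n S j) = (MIN p\<in>S. \<Sum>j=1..i. p j)"
proof -
  let ?L = "majorization_order n"
  define F where "F i = (MIN p\<in>S. \<Sum>j=1..i. p j)" for i
  define M where "M i = (if i = 0 then 0 else F i - F (i - 1))" for i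
  have F_le: "F i \<le> (\<Sum>j=1..i. p j)" if "p \<in> S" for i p
    unfolding F_def using assms(1) that by simp
  have F_in: "\<exists>p\<in>S. F i = (\<Sum>j=1..i. p j)" for i
  proof -
    have "F i \<in> (\<lambda>p. \<Sum>j=1..i. p j) ` S"
      unfolding F_def using assms(1,2) by (intro Min_in) auto
    then show ?thesis by blast
  qed
  have F0: "F 0 = 0" using F_in[of 0] by auto
  have M_sum: "(\<Sum>j=1..i. M j) = F i" for i
    by (induction i) (auto simp: M_def F0)
  have F_ge: "F i = 1" if "i \<ge> n" for i
    using F_in[of i] sum_ordered_dist_ge[OF _ that] assms(3) by fastforce
  have nonneg: "0 \<le> p k" if "p \<in> ordered_dists n" for p k
    using that by (cases "k \<in> {1..n}") (auto simp: ordered_dists_def)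
  have M_nonneg: "0 \<le> M k" for k
  proof (cases k)
    case (Suc k')
    obtain p where p: "p \<in> S" "F k = (\<Sum>j=1..k. p j)" using F_in by blast
    have "F k' \<le> (\<Sum>j=1..k'. p j)" using F_le p by blast
    also have "\<dots> \<le> F k" using p assms(3) nonneg[of p k] by (auto simp: Suc)
    finally show ?thesis by (simp add: M_def Suc)
  qed (simp add: M_def)
  have M_step: "M (Suc k) \<le> M k" if "k \<ge> 1" "k < n" for k
  proof -
    obtain p where p: "p \<in> S" "F k = (\<Sum>j=1..k. p j)" using F_in by blast
    have "F (k - 1) + F (Suc k) \<le> 2 * F k"
      using concave_partial_sums[of p n k] F_le[OF p(1), of "k - 1"] F_le[OF p(1), of "Suc k"]
        p assms(3) that by force
    then show ?thesis using that by (simp add: M_def)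
  qed
  have M_mono: "M b \<le> M a" if "a \<le> b" "1 \<le> a" "b \<le> n" for a b
    using that
  proof (induction b rule: dec_induct)
    case (step b)
    then show ?case using M_step[of b] by force
  qed simp
  have zero: "M k = 0" if "k \<notin> {1..n}" for k
  proof (cases "k = 0")
    case False
    then have "n \<le> k" "n \<le> k - 1" using that by auto
    then show ?thesis by (simp add: M_def F_ge)
  qed (simp add: M_def)
  have M: "M \<in> ordered_dists n"
    unfolding ordered_dists_def monotone_on_def
    using M_nonneg M_mono M_sum[of n] F_ge[of n] zero by auto
  have gr: "greatest ?L M (Lower ?L S)"
  proof -
    have "majorized M p" if "p \<in> S" for p
      unfolding majorized_def M_sum using F_le[OF that] by blast
    then have "M \<in> Lower ?L S"
      using M by (auto simp: Lower_def majorization_order_def)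
    moreover have "majorized q M" if "q \<in> Lower ?L S" for q
      unfolding majorized_def M_sum
    proof
      fix i
      obtain p where p: "p \<in> S" "F i = (\<Sum>j=1..i. p j)" using F_in by blast
      then have "majorized q p"
        using that assms(3) by (auto simp: Lower_def majorization_order_def)
      then show "(\<Sum>j=1..i. q j) \<le> F i"
        using p(2) by (simp add: majorized_def)
    qed
    ultimately show ?thesis
      by (auto simp: greatest_def majorization_order_def Lower_def)
  qed
  then show gr': "greatest ?L (majorization_meet n S) (Lower ?L S)"
    unfolding majorization_meet_def Lattice.inf_def by (rule someI[where P = "\<lambda>x. is_glb ?L x S"])
  have "majorized M (majorization_meet n S)" "majorized (majorization_meet n S) M"
    using gr gr' by (auto simp: greatest_def majorization_order_def)
  then show "(\<Sum>j=1..i. majorization_meet n S j) = (MIN p\<in>S. \<Sum>j=1..i. p j)"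
    using M_sum[of i] F_def[of i] unfolding majorized_def by (metis order_antisym)
qed

end

theory Submission
  imports Defs
begin

text \<open>
  A step removes its output weight from a single entry of each distribution. So before step \<open>i\<close> the
  first \<open>j\<close> entries of each distribution still carry at least
  \<open>\<Sum>k\<le>j. \<M>\<^sub>S k - \<Sum>k<i. \<G>\<^sub>S k\<close>, and the largest entry is at least a \<open>j\<close>-th of that.
\<close>

text \<open>The witness is a distribution attaining the minimum that defines \<open>g\<close>. Its
  largest entry equals \<open>g\<close>, so each of its first \<open>j\<close> entries is at most
  \<open>g\<close>.\<close>

lemma greedy_step_sum_le:
  assumes "greedy_step m n P g Q" "m \<ge> 1" "j \<le> n"
  shows "\<exists>l\<in>{1..m}. (\<Sum>k=1..j. P l k) \<le> real j * g"
proof -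
  obtain \<kappa> where \<kappa>: "\<forall>l\<in>{1..m}. is_arg_max (P l) (\<lambda>k. k \<in> {1..n}) (\<kappa> l)"
    and g: "g = (MIN l\<in>{1..m}. P l (\<kappa> l))"
    using assms(1) by (auto simp: greedy_step_def)
  have "g \<in> (\<lambda>l. P l (\<kappa> l)) ` {1..m}"
    unfolding g using assms(2) by (intro Min_in) auto
  then obtain l where l: "l \<in> {1..m}" "g = P l (\<kappa> l)" by blast
  have "P l k \<le> g" if "k \<in> {1..j}" for k
    using \<kappa> l that assms(3) by (auto simp: is_arg_max_linorder)
  then have "(\<Sum>k=1..j. P l k) \<le> real j * g"
    using sum_bounded_above[of "{1..j}" "P l" g] by simp
  with l(1) show ?thesis by blast
qed

text \<open>The weight is a minimum of maxima: it is nonnegative when all entries are, and never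
  exceeds the entry it is subtracted from.\<close>

lemma greedy_step_nonneg:
  assumes "greedy_step m n P g Q" "m \<ge> 1"
    and "\<And>l k. l \<in> {1..m} \<Longrightarrow> k \<in> {1..n} \<Longrightarrow> 0 \<le> P l k"
  shows "0 \<le> g"
    and "\<And>l k. l \<in> {1..m} \<Longrightarrow> k \<in> {1..n} \<Longrightarrow> 0 \<le> Q l k"
proof -
  obtain \<kappa> where \<kappa>: "\<forall>l\<in>{1..m}. is_arg_max (P l) (\<lambda>k. k \<in> {1..n}) (\<kappa> l)"
    and g: "g = (MIN l\<in>{1..m}. P l (\<kappa> l))"
    and Q: "\<forall>l\<in>{1..m}. Q l = (P l)(\<kappa> l := P l (\<kappa> l) - g)"
    using assms(1) by (auto simp: greedy_step_def)
  have "\<kappa> l \<in> {1..n}" if "l \<in> {1..m}" for l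
    using \<kappa> that by (auto simp: is_arg_max_def)
  then show "0 \<le> g"
    unfolding g using assms(2,3) by (subst Min_ge_iff) auto
  have "g \<le> P l (\<kappa> l)" if "l \<in> {1..m}" for l
    unfolding g using that by simp
  then show "0 \<le> Q l k" if "l \<in> {1..m}" "k \<in> {1..n}" for l k
    using Q that assms(3) by auto
qed

text \<open>Only one index \<open>a\<close> changes, so the sum drops by \<open>g\<close> if
  \<open>a\<close> lies in \<open>A\<close> and by nothing otherwise. The second case is where
  \<open>0 \<le> g\<close> enters.\<close>

lemma greedy_step_sum_ge:
  assumes "greedy_step m n P g Q" "l \<in> {1..m}" "0 \<le> g" "finite A"
  shows "(\<Sum>k\<in>A. P l k) - g \<le> (\<Sum>k\<in>A. Q l k)"
proof -
  obtain a where "Q l = (P l)(a := P l a - g)"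
    using assms(1,2) by (auto simp: greedy_step_def)
  then have "Q l k = P l k - (if k = a then g else 0)" for k
    by simp
  then show ?thesis
    using assms(3,4) by (simp add: sum_subtractf)
qed

text \<open>Nonnegativity is carried along with the bound on prefix sums because each step loses at
  most \<open>G t\<close> only once \<open>0 \<le> G t\<close> is known.\<close>

lemma greedy_run_invariant:
  assumes "m \<ge> 1"
    and "\<And>l k. l \<in> {1..m} \<Longrightarrow> k \<in> {1..n} \<Longrightarrow> 0 \<le> p l k"
    and "\<forall>l\<in>{1..m}. P 1 l = p l"
    and "\<forall>t\<ge>1. if (\<Sum>k=1..n. P t 1 k) > 0
           then greedy_step m n (P t) (G t) (P (Suc t))
           else G t = 0 \<and> (\<forall>l\<in>{1..m}. P (Suc t) l = P t l)"
    and "t \<ge> 1" and "l \<in> {1..m}"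
  shows "(\<forall>k\<in>{1..n}. 0 \<le> P t l k) \<and>
    (\<Sum>k=1..j. p l k) - (\<Sum>k=1..t-1. G k) \<le> (\<Sum>k=1..j. P t l k)"
  using assms(5,6)
proof (induction t arbitrary: l rule: dec_induct)
  case base
  then show ?case using assms(2,3) by simp
next
  case (step t)
  \<comment> \<open>The truncated \<open>t - 1\<close> is harmless here since \<open>t\<close> is at
    least 1.\<close>
  have sum_G: "(\<Sum>k=1..Suc t - 1. G k) = (\<Sum>k=1..t-1. G k) + G t"
    using step.hyps by (cases t) auto
  show ?case
  proof (cases "(\<Sum>k=1..n. P t 1 k) > 0")
    case True
    then have gs: "greedy_step m n (P t) (G t) (P (Suc t))"
      using assms(4) step.hyps by auto
    \<comment> \<open>The weight depends on all distributions, so the induction hypothesis is used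
      for every \<open>l'\<close>, not just for \<open>l\<close>; hence the induction generalizes
      over \<open>l\<close>.\<close>
    have nn: "0 \<le> P t l' k" if "l' \<in> {1..m}" "k \<in> {1..n}" for l' k
      using step.IH that by blast
    have "(\<Sum>k=1..j. P t l k) - G t \<le> (\<Sum>k=1..j. P (Suc t) l k)"
      using greedy_step_sum_ge[OF gs step.prems greedy_step_nonneg(1)[OF gs assms(1) nn]] by simp
    then show ?thesis
      using greedy_step_nonneg(2)[OF gs assms(1) nn] step.IH[OF step.prems] step.prems sum_G
      by auto
  next
    case False
    then have "G t = 0" "P (Suc t) l = P t l"
      using assms(4) step.hyps step.prems by auto
    then show ?thesis using step.IH[OF step.prems] sum_G by simp
  qed
qed

theorem theorem1:
  fixes m n i :: nat and p :: "nat \<Rightarrow> nat \<Rightarrow> real" and G :: "nat \<Rightarrow> real"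
  assumes "m \<ge> 1" and "n \<ge> 1"
    and "\<And>l. l \<in> {1..m} \<Longrightarrow> p l \<in> ordered_dists n"
    and "greedy_output m n p G"
    and "i \<ge> 1"
  shows "G i \<ge> (MAX j\<in>{1..n}.
           ((\<Sum>k=1..j. majorization_meet n (p ` {1..m}) k) - (\<Sum>k=1..i-1. G k)) / real j)"
proof -
  let ?M = "majorization_meet n (p ` {1..m})"
  obtain P where P1: "\<forall>l\<in>{1..m}. P 1 l = p l"
    and run: "\<forall>t\<ge>1. if (\<Sum>k=1..n. P t 1 k) > 0
           then greedy_step m n (P t) (G t) (P (Suc t))
           else G t = 0 \<and> (\<forall>l\<in>{1..m}. P (Suc t) l = P t l)"
    using assms(4) unfolding greedy_output_def by blast
  have p_nonneg: "0 \<le> p l k" if "l \<in> {1..m}" "k \<in> {1..n}" for l k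
    using assms(3)[OF that(1)] that(2) by (auto simp: ordered_dists_def)
  note inv = greedy_run_invariant[OF assms(1) p_nonneg P1 run assms(5)]
  have "((\<Sum>k=1..j. ?M k) - (\<Sum>k=1..i-1. G k)) / real j \<le> G i" if j: "j \<in> {1..n}" for j
  proof -
    \<comment> \<open>This is shown for every \<open>l\<close>, since the distribution that attains
      the minimum at step \<open>i\<close> is not known in advance.\<close>
    have rem: "(\<Sum>k=1..j. ?M k) - (\<Sum>k=1..i-1. G k) \<le> (\<Sum>k=1..j. P i l k)"
      if l: "l \<in> {1..m}" for l
    proof -
      have "(\<Sum>k=1..j. ?M k) = (MIN q\<in>p ` {1..m}. \<Sum>k=1..j. q k)"
        using assms(1,3) by (intro majorization_meet(2)) auto
      also have "\<dots> \<le> (\<Sum>k=1..j. p l k)"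
        using l by (intro Min_le) auto
      finally show ?thesis using inv[OF _ _ l, of j] by force
    qed
    have "\<exists>l\<in>{1..m}. (\<Sum>k=1..j. P i l k) \<le> real j * G i"
    proof (cases "(\<Sum>k=1..n. P i 1 k) > 0")
      case True
      then show ?thesis
        using run assms(1,5) j greedy_step_sum_le[of m n "P i" "G i" "P (Suc i)" j] by auto
    next
      case False
      \<comment> \<open>After termination the first distribution serves as witness, as the stopping
        test reads its total mass. Its entries are nonnegative, so its prefix sum is at most that
        total, hence at most 0, which is \<open>real j * G i\<close>.\<close>
      have one: "1 \<in> {1..m}" using assms(1) by simp
      have "(\<Sum>k=1..j. P i 1 k) \<le> (\<Sum>k=1..n. P i 1 k)"
        using j inv[OF _ _ one] by (intro sum_mono2) auto
      moreover have "G i = 0" using False run assms(5) by auto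
      ultimately show ?thesis using False one by (intro bexI[of _ 1]) auto
    qed
    then obtain l where "l \<in> {1..m}" "(\<Sum>k=1..j. P i l k) \<le> real j * G i" by blast
    with rem[of l] have "(\<Sum>k=1..j. ?M k) - (\<Sum>k=1..i-1. G k) \<le> real j * G i" by linarith
    then show ?thesis using j by (simp add: divide_le_eq mult.commute)
  qed
  then show ?thesis
    using assms(2) by (subst Max_le_iff) auto
qed

end
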